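(* Let $\mathbb{F}$ be a field of characteristic $0$. Suppose that $\big(g(x),F(x)\big)\in\mathcal{R}(\mathbb{F})$ has finite order, where $g(x)=g_0+g_1x+\cdots$ and $F(x)=\omega x+f_2x^2+\cdots$, and that the compositional order of $F(x)$, which equals $\mathrm{ord}(\omega)$, is $b>1$. Set $\widehat{g}(x)=\frac{1}{g_0}g(x)$ and let $$h(x)=\Big(\widehat{g}^{\frac1b}(x)\Big)^{b-1}\Big(\widehat{g}^{\frac1b}\big(F(x)\big)\Big)^{b-2}\Big(\widehat{g}^{\frac1b}\big(F^{(2)}(x)\big)\Big)^{b-3}\cdots\Big(\widehat{g}^{\frac1b}\big(F^{(b-2)}(x)\big)\Big),\qquad \Sigma_F=\frac1b\sum_{j=1}^b\omega^jF^{(b-j)}(x).$$ Then: - $v(x)$ is the generating function of an eigenvector of $\big(g(x),F(x)\big)$ if and only if $$v(x)=h(x)\cdot(\theta\circ\Sigma_F)(x)\ \big(=h_0\theta_kx^k+\cdots\big),$$ where, for some integer $k\ge0$, $\theta(x)=\sum_{j=0}^\infty\theta_{k+jb}\,x^{k+jb}$ with coefficients in $\mathbb{F}$ and $\theta_k\ne0$ (here $h_0$ is the constant term of $h$). - The eigenvalue for such $v(x)$ is $g_0\omega^k$.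
   Context: $\mathbb{F}_0[[x]]$ is the group, under multiplication, of formal power series over $\mathbb{F}$ with nonzero constant term. $\mathbb{F}_1[[x]]$ is the group, under composition, of formal power series $f_1x+f_2x^2+\cdots$ over $\mathbb{F}$ with $f_1\ne0$. $F^{(m)}$ denotes the $m$-fold composite of $F$ with itself ($F^{(0)}(x)=x$). The Riordan group $\mathcal{R}(\mathbb{F})$ is the set $\mathbb{F}_0[[x]]\times\mathbb{F}_1[[x]]$ with operation $\big(g(x),F(x)\big)\big(h(x),K(x)\big)=\big(g(x)\cdot h(F(x)),\,K(F(x))\big)$ and identity $(1,x)$. The order of a group element is the least positive integer $n$ for which its $n$-th power is the identity; $\mathrm{ord}(\omega)$ is the order of $\omega$ in $\mathbb{F}\setminus\{0\}$. An element $\big(g(x),F(x)\big)$ is identified with the infinite lower triangular matrix $[d_{n,j}]_{n,j\ge0}$ over $\mathbb{F}$ with $d_{n,j}=[x^n]\,g(x)F(x)^j$, acting on column vectors $\vec v=(v_0,v_1,\ldots)^T$ with entries in $\mathbb{F}$; the generating function of $\vec v$ is $v(x)=\sum_{n\ge0}v_nx^n$. Eigenvectors (nonzero) and eigenvalues are those of this matrix. For a series $u(x)=1+b_1x+\cdots$ and a positive integer $m$, $u^{\frac1m}(x)$ denotes the unique $m$-th root of $u(x)$ of the form $1+c_1x+\cdots$. The product defining $h(x)$ is $\prod_{i=0}^{b-2}\big(\widehat{g}^{\frac1b}(F^{(i)}(x))\big)^{b-1-i}$. *)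

theory Defs
  imports
    "HOL-Computational_Algebra.Formal_Power_Series"
    "HOL-Algebra.Multiplicative_Group"
begin

unbundle fps_syntax

definition nonzero_group :: "'a::field monoid" where
  "nonzero_group = \<lparr>carrier = {c. c \<noteq> 0}, mult = (*), one = 1\<rparr>"

definition fps_comp_group :: "'a::field fps monoid" where
  "fps_comp_group =
     \<lparr>carrier = {F. F $ 0 = 0 \<and> F $ 1 \<noteq> 0}, mult = (oo), one = fps_X\<rparr>"

(* Note K oo F stands for K(F(x)). *)
definition riordan_group :: "('a::field fps \<times> 'a fps) monoid" where
  "riordan_group =
     \<lparr>carrier = {g. g $ 0 \<noteq> 0} \<times> carrier fps_comp_group,
      mult = (\<lambda>(g, F) (h, K). (g * (h oo F), K oo F)),
      one = (1, fps_X)\<rparr>"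

(* Since the three structures above are groups, group.ord is the least positive
   exponent giving the identity, and 0 for elements of infinite order. *)
lemma group_nonzero_group: "group (nonzero_group :: 'a::field monoid)"
  by (rule groupI) (auto simp: nonzero_group_def intro: exI[of _ "inverse _"])

lemma fps_compose_nth_1: "F $ 0 = 0 \<Longrightarrow> (K oo F) $ 1 = K $ 1 * F $ 1"
  for F K :: "'a::field fps"
  by (simp add: fps_compose_nth)

lemma fps_inv_nth_0: "fps_inv F $ 0 = 0"
  by (simp add: fps_inv_def)

lemma fps_inv_nth_1: "F $ 1 \<noteq> 0 \<Longrightarrow> fps_inv F $ 1 = 1 / F $ 1"
  for F :: "'a::field fps"
  by (simp add: fps_inv_def)

lemma group_fps_comp_group: "group (fps_comp_group :: 'a::field fps monoid)"
proof (rule groupI)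
  fix F :: "'a fps"
  assume "F \<in> carrier fps_comp_group"
  then have F: "F $ 0 = 0" "F $ 1 \<noteq> 0"
    by (auto simp: fps_comp_group_def)
  show "\<exists>K\<in>carrier fps_comp_group. K \<otimes>\<^bsub>fps_comp_group\<^esub> F = \<one>\<^bsub>fps_comp_group\<^esub>"
    using F fps_inv[OF F]
    by (intro bexI[of _ "fps_inv F"])
       (auto simp: fps_comp_group_def fps_inv_nth_0 fps_inv_nth_1 simp del: One_nat_def)
qed (auto simp: fps_comp_group_def fps_compose_nth_1 fps_compose_assoc
          simp del: One_nat_def)

lemma group_riordan_group: "group (riordan_group :: ('a::field fps \<times> 'a fps) monoid)"
proof (rule groupI)
  fix x :: "'a fps \<times> 'a fps"
  assume "x \<in> carrier riordan_group"
  then obtain g F where x: "x = (g, F)" and g: "g $ 0 \<noteq> 0" and F: "F $ 0 = 0" "F $ 1 \<noteq> 0"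
    by (auto simp: riordan_group_def fps_comp_group_def)
  let ?K = "fps_inv F"
  let ?h = "inverse (g oo ?K)"
  have "?h * (g oo ?K) = 1"
    using g by (intro inverse_mult_eq_1) simp
  then show "\<exists>y\<in>carrier riordan_group. y \<otimes>\<^bsub>riordan_group\<^esub> x = \<one>\<^bsub>riordan_group\<^esub>"
    using g F fps_inv_right[OF F]
    by (intro bexI[of _ "(?h, ?K)"])
       (auto simp: x riordan_group_def fps_comp_group_def fps_inv_nth_0 fps_inv_nth_1
             simp del: One_nat_def)
qed (auto simp: riordan_group_def fps_comp_group_def fps_compose_nth_1 fps_compose_assoc
                fps_compose_mult_distrib mult.assoc
          simp del: One_nat_def)

abbreviation fps_iterate :: "'a::field fps \<Rightarrow> nat \<Rightarrow> 'a fps" where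
  "fps_iterate F m \<equiv> F [^]\<^bsub>fps_comp_group\<^esub> m"

definition riordan_matrix :: "'a::field fps \<times> 'a fps \<Rightarrow> nat \<Rightarrow> nat \<Rightarrow> 'a" where
  "riordan_matrix = (\<lambda>(g, F) n j. (g * F ^ j) $ n)"

lemma riordan_matrix_lower_triangular:
  assumes "F $ 0 = 0" and "n < j"
  shows "riordan_matrix (g, F) n j = 0"
proof -
  have "(F ^ j) $ i = 0" if "i \<le> n" for i
    using assms that startsby_zero_power_prefix[of F j] by auto
  then show ?thesis
    by (auto simp: riordan_matrix_def fps_mult_nth intro!: sum.neutral)
qed

(* Meant for lower triangular matrices, whose n-th row vanishes beyond column n. *)
definition lower_triangular_apply ::
    "(nat \<Rightarrow> nat \<Rightarrow> 'a::field) \<Rightarrow> (nat \<Rightarrow> 'a) \<Rightarrow> nat \<Rightarrow> 'a" where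
  "lower_triangular_apply D v = (\<lambda>n. \<Sum>j\<le>n. D n j * v j)"

definition is_eigenvector ::
    "(nat \<Rightarrow> nat \<Rightarrow> 'a::field) \<Rightarrow> (nat \<Rightarrow> 'a) \<Rightarrow> 'a \<Rightarrow> bool" where
  "is_eigenvector D v c \<longleftrightarrow>
     v \<noteq> (\<lambda>_. 0) \<and> lower_triangular_apply D v = (\<lambda>n. c * v n)"

(* The radical whose constant term is chosen to be 1. *)
definition fps_unit_root :: "nat \<Rightarrow> 'a::field_char_0 fps \<Rightarrow> 'a fps" where
  "fps_unit_root m u = fps_radical (\<lambda>_ _. 1) m u"

lemma fps_unit_root_unique:
  fixes u w :: "'a::field_char_0 fps"
  assumes "m > 0" and "u $ 0 = 1"
  shows "w $ 0 = 1 \<and> w ^ m = u \<longleftrightarrow> w = fps_unit_root m u"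
proof -
  from \<open>m > 0\<close> obtain k where m: "m = Suc k"
    using gr0_implies_Suc by blast
  have "fps_unit_root m u ^ m = u"
    using power_radical[of u "\<lambda>_ _. 1" k] assms m by (simp add: fps_unit_root_def)
  moreover have "w = fps_unit_root m u" if "w $ 0 = 1" "w ^ m = u"
    using radical_unique[of "\<lambda>_ _. 1" k u w] assms m that by (simp add: fps_unit_root_def)
  ultimately show ?thesis
    using m by (auto simp: fps_unit_root_def)
qed

definition riordan_h :: "'a::field_char_0 fps \<Rightarrow> 'a fps \<Rightarrow> nat \<Rightarrow> 'a fps" where
  "riordan_h g F b =
     (let g_hat = fps_const (1 / g $ 0) * g
      in \<Prod>i=0..b-2. (fps_unit_root b g_hat oo fps_iterate F i) ^ (b - 1 - i))"

definition riordan_sigma :: "'a::field_char_0 fps \<Rightarrow> nat \<Rightarrow> 'a fps" where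
  "riordan_sigma F b =
     fps_const (1 / of_nat b) *
     (\<Sum>j=1..b. fps_const ((F $ 1) ^ j) * fps_iterate F (b - j))"

definition has_progression_support :: "nat \<Rightarrow> nat \<Rightarrow> 'a::field fps \<Rightarrow> bool" where
  "has_progression_support k b \<theta> \<longleftrightarrow>
     \<theta> $ k \<noteq> 0 \<and> (\<forall>n. \<theta> $ n \<noteq> 0 \<longrightarrow> (\<exists>j. n = k + j * b))"

end

theory Submission
  imports Defs
begin

text \<open>
  Write \<open>F\<^bsup>(i)\<^esup>\<close> for the \<open>i\<close>-fold iterate of \<open>F\<close>. The matrix of \<open>(g, F)\<close> sends the column with
  generating function \<open>v\<close> to the one with generating function \<open>g \<cdot> (v \<circ> F)\<close> (\<open>riordan_matrix_apply\<close>), so an eigenvector is a nonzero solution of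
  \<open>g \<cdot> (v \<circ> F) = c v\<close>. The two series in the statement serve to bring this equation into diagonal form.

  The averaged series \<open>\<Sigma>\<close> linearises \<open>F\<close>: since \<open>F\<close> has \<open>b\<close>-th iterate \<open>x\<close> and \<open>\<omega>\<^sup>b = 1\<close>, composing
  \<open>\<Sigma>\<close> with \<open>F\<close> permutes its summands cyclically up to the factor \<open>\<omega>\<close>, which gives
  \<open>\<Sigma> \<circ> F = \<omega> \<Sigma>\<close> (\<open>riordan_sigma_compose\<close>). As \<open>\<Sigma> = x + \<cdots>\<close> is invertible, \<open>F\<close> is conjugate to
  \<open>\<omega> x\<close>; in particular \<open>F\<close> and \<open>\<omega>\<close> have the same order.

  The series \<open>h\<close> trivialises the weight: \<open>g \<cdot> (h \<circ> F) = g\<^sub>0 h\<close> (\<open>riordan_h_eigen\<close>). With \<open>u\<close> the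
  \<open>b\<close>-th root of \<open>g / g\<^sub>0\<close>, passing from \<open>h\<close> to \<open>h \<circ> F\<close> shifts the iterates of \<open>F\<close> by one, so that
  \<open>u\<^sup>b \<cdot> (h \<circ> F)\<close> is \<open>h\<close> times the product of \<open>u \<circ> F\<^bsup>(i)\<^esup>\<close> over a full orbit \<open>i < b\<close>. That product
  is 1 because \<open>(g, F)\<close> has finite order (\<open>orbit_prod_eq_1\<close>).

  Every series can be written as \<open>v = h \<cdot> (\<theta> \<circ> \<Sigma>)\<close>, and in these coordinates the eigenvalue equation
  becomes \<open>g\<^sub>0 \<theta>(\<omega> x) = c \<theta>(x)\<close>, that is \<open>g\<^sub>0 \<omega>\<^sup>n \<theta>\<^sub>n = c \<theta>\<^sub>n\<close> for all \<open>n\<close>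
  (\<open>conjugated_eigen_equation\<close>). If \<open>k\<close> is the least index with \<open>\<theta>\<^sub>k \<noteq> 0\<close>, this forces
  \<open>c = g\<^sub>0 \<omega>\<^sup>k\<close>, and \<open>\<theta>\<^sub>n\<close> may be nonzero exactly where \<open>\<omega>\<^sup>n = \<omega>\<^sup>k\<close>, which means
  \<open>n \<equiv> k\<close> modulo \<open>b\<close>.
\<close>

section \<open>Powers in the Riordan group\<close>

lemma fps_comp_group_one [simp]: "\<one>\<^bsub>fps_comp_group\<^esub> = fps_X"
  by (simp add: fps_comp_group_def)

lemma fps_comp_group_mult [simp]: "F \<otimes>\<^bsub>fps_comp_group\<^esub> K = F oo K"
  by (simp add: fps_comp_group_def)

lemma fps_iterate_nth_0: "F $ 0 = 0 \<Longrightarrow> fps_iterate F m $ 0 = 0"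
  for F :: "'a::field fps"
  by (induction m) auto

lemma fps_iterate_nth_1: "F $ 0 = 0 \<Longrightarrow> fps_iterate F m $ 1 = (F $ 1) ^ m"
  for F :: "'a::field fps"
  by (induction m) (simp_all add: fps_compose_nth_1 mult.commute del: One_nat_def)

lemma fps_iterate_fps_X [simp]: "fps_iterate (fps_X :: 'a::field fps) m = fps_X"
  by (induction m) simp_all

text \<open>
  An iterate grows by composing with \<open>F\<close> on the inside. The Riordan product reverses its second
  components, so there a power grows by composing with \<open>F\<close> on the outside; the two agree.
\<close>

lemma fps_iterate_compose_commute:
  fixes F :: "'a::field fps"
  assumes "F \<in> carrier fps_comp_group"
  shows "F oo fps_iterate F m = fps_iterate F m oo F"
proof -
  have "monoid (fps_comp_group :: 'a fps monoid)"
    by (rule group.is_monoid[OF group_fps_comp_group])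
  from monoid.nat_pow_Suc2[OF this assms, of m] show ?thesis
    by simp
qed

lemma fps_compose_iterate:
  fixes F :: "'a::field fps"
  assumes "F $ 0 = 0"
  shows "(u oo fps_iterate F i) oo F = u oo fps_iterate F (Suc i)"
  using assms by (simp add: fps_compose_assoc fps_iterate_nth_0)

text \<open>
  The first component collects the weight along the orbit of \<open>F\<close>, like a cocycle.
\<close>

lemma riordan_power:
  fixes g F :: "'a::field fps"
  assumes "F \<in> carrier fps_comp_group"
  shows "(g, F) [^]\<^bsub>riordan_group\<^esub> m = (\<Prod>i<m. g oo fps_iterate F i, fps_iterate F m)"
proof (induction m)
  case 0
  show ?case by (simp add: riordan_group_def)
next
  case (Suc m)
  then show ?case
    using fps_iterate_compose_commute[OF assms, of m]
    by (simp add: riordan_group_def)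
qed

section \<open>The orbit product of the weight\<close>

lemma fps_power_eq_1D:
  fixes u :: "'a::field_char_0 fps"
  assumes "m > 0" "u $ 0 = 1" "u ^ m = 1"
  shows "u = 1"
  using fps_unit_root_unique[of m 1 u] fps_unit_root_unique[of m 1 1] assms by simp

lemma fps_power_nth_0: "(u ^ m) $ 0 = (u $ 0) ^ m"
  for u :: "'a::field fps"
  by (induction m) auto

lemma fps_prod_nth_0: "(\<Prod>i\<in>A. f i) $ 0 = (\<Prod>i\<in>A. f i $ 0)"
  for f :: "'i \<Rightarrow> 'a::field fps"
  by (induction A rule: infinite_finite_induct) auto

text \<open>
  Let \<open>P\<close> be the product of \<open>g \<circ> F\<^bsup>(i)\<^esup>\<close> over one period, so that \<open>(g, F)\<^sup>b = (P, x)\<close>. The order of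
  \<open>(g, F)\<close> is a multiple \<open>b q\<close> of \<open>b\<close>, hence \<open>(1, x) = (P, x)\<^sup>q = (P\<^sup>q, x)\<close>. The orbit product \<open>U\<close> of
  \<open>u\<close> has \<open>b\<close>-th power \<open>P\<close> up to a constant factor, so its \<open>b q\<close>-th power is a constant. Since
  \<open>U\<close> has constant term 1, that constant is 1, and 1 has only one root with constant term 1.
\<close>

lemma orbit_prod_eq_1:
  fixes g F u :: "'a::field_char_0 fps"
  assumes carrier: "(g, F) \<in> carrier riordan_group"
    and ord: "group.ord riordan_group (g, F) > 0"
    and ord_F: "group.ord fps_comp_group F = b" and b: "b > 0"
    and u: "u $ 0 = 1" "u ^ b = fps_const (1 / g $ 0) * g"
  shows "(\<Prod>i<b. u oo fps_iterate F i) = 1"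
proof -
  interpret R: group "riordan_group :: ('a fps \<times> 'a fps) monoid"
    by (rule group_riordan_group)
  interpret C: group "fps_comp_group :: 'a fps monoid"
    by (rule group_fps_comp_group)
  have F: "F \<in> carrier fps_comp_group" and F0: "F $ 0 = 0" and g0: "g $ 0 \<noteq> 0"
    using carrier by (auto simp: riordan_group_def fps_comp_group_def)
  define P where "P = (\<Prod>i<b. g oo fps_iterate F i)"
  define U where "U = (\<Prod>i<b. u oo fps_iterate F i)"
  define n where "n = R.ord (g, F)"
  have one: "(g, F) [^]\<^bsub>riordan_group\<^esub> n = (1, fps_X)"
    using R.pow_ord_eq_1[OF carrier] by (simp add: n_def riordan_group_def)
  have "fps_iterate F n = \<one>\<^bsub>fps_comp_group\<^esub>"
    using one riordan_power[OF F, of g n] by (simp add: fps_comp_group_def)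
  then have "b dvd n"
    using C.pow_eq_id[OF F] ord_F by simp
  then obtain q where n: "n = b * q" by blast
  have q: "q > 0" using ord n by (simp add: n_def[symmetric])
  have Fb: "fps_iterate F b = fps_X"
    using C.pow_ord_eq_1[OF F] ord_F by (simp add: fps_comp_group_def)
  have X: "fps_X \<in> carrier (fps_comp_group :: 'a fps monoid)"
    by (simp add: fps_comp_group_def)
  have "((g, F) [^]\<^bsub>riordan_group\<^esub> b) [^]\<^bsub>riordan_group\<^esub> q = (1, fps_X)"
    using one R.nat_pow_pow[OF carrier, of b q] n by simp
  then have Pq: "P ^ q = 1"
    by (simp add: riordan_power[OF F] Fb riordan_power[OF X] P_def)
  have "U ^ b = (\<Prod>i<b. u ^ b oo fps_iterate F i)"
    by (simp add: U_def prod_power_distrib fps_compose_power fps_iterate_nth_0 F0)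
  also have "\<dots> = (\<Prod>i<b. fps_const (1 / g $ 0) * (g oo fps_iterate F i))"
    by (simp add: u fps_compose_mult_distrib fps_iterate_nth_0 F0)
  also have "\<dots> = fps_const ((1 / g $ 0) ^ b) * P"
    by (simp add: P_def prod.distrib)
  finally have Ub: "U ^ b = fps_const ((1 / g $ 0) ^ b) * P" .
  have U0: "U $ 0 = 1"
    by (simp add: U_def fps_prod_nth_0 u)
  have Ubq: "U ^ (b * q) = fps_const (((1 / g $ 0) ^ b) ^ q)"
    by (simp add: power_mult Ub power_mult_distrib Pq)
  have "((1 / g $ 0) ^ b) ^ q = 1"
    using arg_cong[OF Ubq, of "\<lambda>f. f $ 0"] U0 by (simp add: fps_power_nth_0)
  then have "U = 1"
    using Ubq fps_power_eq_1D[of "b * q" U] U0 b q by simp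
  then show ?thesis by (simp add: U_def)
qed

text \<open>
  Both sides are the product of \<open>a i ^ (b - i)\<close> over \<open>i < b\<close>: the left side splits off the factor \<open>i = 0\<close>,
  the right side takes one copy of every \<open>a i\<close> out. With \<open>a i = u \<circ> F\<^bsup>(i)\<^esup>\<close> the weighted product on the right is
  \<open>h\<close>, and the one on the left is \<open>h \<circ> F\<close>.
\<close>

lemma prod_weighted_shift:
  fixes a :: "nat \<Rightarrow> 'a::comm_monoid_mult"
  assumes "b > 1"
  shows "(\<Prod>i=0..b-2. a (Suc i) ^ (b - 1 - i)) * (a 0 ^ b)
       = (\<Prod>i=0..b-2. a i ^ (b - 1 - i)) * (\<Prod>i<b. a i)"
proof -
  obtain c where b: "b = Suc c" using assms by (cases b) auto
  have eq: "{0..b-2} = {..<c}" using assms b by auto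
  have "(\<Prod>i<b. a i ^ (b - i)) = a 0 ^ b * (\<Prod>i<c. a (Suc i) ^ (c - i))"
    unfolding b by (subst prod.lessThan_Suc_shift) simp
  moreover have "(\<Prod>i<b. a i ^ (b - i)) = (\<Prod>i<b. a i ^ (c - i)) * (\<Prod>i<b. a i)"
    unfolding b prod.distrib[symmetric]
    by (intro prod.cong) (auto simp: Suc_diff_le mult.commute)
  moreover have "(\<Prod>i<b. a i ^ (c - i)) = (\<Prod>i<c. a i ^ (c - i))"
    by (simp add: b)
  ultimately show ?thesis
    unfolding eq by (simp add: b mult_ac)
qed

lemma riordan_h_nth_0:
  assumes "b > 0" "g $ 0 \<noteq> 0"
  shows "riordan_h g F b $ 0 = 1"
proof -
  have "(fps_const (1 / g $ 0) * g) $ 0 = 1"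
    using assms by simp
  then have "fps_unit_root b (fps_const (1 / g $ 0) * g) $ 0 = 1"
    using fps_unit_root_unique[OF assms(1)] by blast
  then show ?thesis
    by (simp add: riordan_h_def Let_def fps_prod_nth_0 fps_power_nth_0)
qed

lemma riordan_h_eigen:
  fixes g F :: "'a::field_char_0 fps"
  assumes carrier: "(g, F) \<in> carrier riordan_group"
    and ord: "group.ord riordan_group (g, F) > 0"
    and ord_F: "group.ord fps_comp_group F = b" and b: "b > 1"
  shows "g * (riordan_h g F b oo F) = fps_const (g $ 0) * riordan_h g F b"
proof -
  have F: "F $ 0 = 0" and g0: "g $ 0 \<noteq> 0"
    using carrier by (auto simp: riordan_group_def fps_comp_group_def)
  define gh where "gh = fps_const (1 / g $ 0) * g"
  define u where "u = fps_unit_root b gh"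
  have "gh $ 0 = 1" using g0 by (simp add: gh_def)
  then have u: "u $ 0 = 1" "u ^ b = gh"
    using fps_unit_root_unique[of b gh u] b by (auto simp: u_def)
  define a where "a i = u oo fps_iterate F i" for i
  have h: "riordan_h g F b = (\<Prod>i=0..b-2. a i ^ (b - 1 - i))"
    by (simp add: riordan_h_def Let_def a_def u_def gh_def)
  have "a i oo F = a (Suc i)" for i
    unfolding a_def by (rule fps_compose_iterate[OF F])
  then have hF: "riordan_h g F b oo F = (\<Prod>i=0..b-2. a (Suc i) ^ (b - 1 - i))"
    by (simp add: h fps_compose_prod_distrib fps_compose_power[symmetric] F)
  have "(\<Prod>i<b. a i) = 1"
    unfolding a_def using b u by (intro orbit_prod_eq_1[OF carrier ord ord_F]) (auto simp: gh_def)
  moreover have "a 0 ^ b = gh"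
    by (simp add: a_def u)
  ultimately have "(riordan_h g F b oo F) * gh = riordan_h g F b"
    using prod_weighted_shift[OF b, of a] unfolding hF by (simp add: h)
  then have "fps_const (g $ 0) * gh * (riordan_h g F b oo F) = fps_const (g $ 0) * riordan_h g F b"
    by (simp add: mult.assoc mult.commute[of gh])
  moreover have "g = fps_const (g $ 0) * gh"
    using g0 by (simp add: gh_def mult.assoc[symmetric])
  ultimately show ?thesis
    by simp
qed

section \<open>The averaged series\<close>

context
  fixes F :: "'a::field_char_0 fps" and b :: nat
  assumes F: "F $ 0 = 0"
    and b: "b > 0" and Fb: "fps_iterate F b = fps_X"
begin

lemma multiplier_power_eq_1: "(F $ 1) ^ b = 1"
  using fps_iterate_nth_1[OF F, of b] Fb by simp

lemma riordan_sigma_nth_0: "riordan_sigma F b $ 0 = 0"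
  by (simp add: riordan_sigma_def fps_sum_nth fps_iterate_nth_0 F)

lemma riordan_sigma_nth_1: "riordan_sigma F b $ 1 = 1"
proof -
  have "(F $ 1) ^ j * (F $ 1) ^ (b - j) = 1" if "j \<in> {1..b}" for j
    using that multiplier_power_eq_1 by (simp add: power_add[symmetric])
  then show ?thesis
    using b by (simp add: riordan_sigma_def fps_sum_nth fps_iterate_nth_1 F del: One_nat_def)
qed

text \<open>
  Composing the summand \<open>j + 1\<close> with \<open>F\<close> gives \<open>\<omega>\<close> times the summand \<open>j\<close>. The summands \<open>0\<close> and \<open>b\<close>
  agree since \<open>F\<^bsup>(b)\<^esup> = x\<close> and \<open>\<omega>\<^sup>b = 1\<close>, so the sum is cyclic.
\<close>

lemma riordan_sigma_compose:
  "riordan_sigma F b oo F = fps_const (F $ 1) * riordan_sigma F b"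
proof -
  let ?w = "F $ 1"
  define t where "t j = fps_const (?w ^ j) * fps_iterate F (b - j)" for j
  have step: "t (Suc j) oo F = fps_const ?w * t j" if "j < b" for j
  proof -
    have "b - j = Suc (b - Suc j)" using that by simp
    then show ?thesis
      by (simp add: t_def fps_compose_mult_distrib F mult.assoc[symmetric])
  qed
  have ends: "t 0 = t b"
    by (simp add: t_def Fb multiplier_power_eq_1 del: One_nat_def)
  have shift: "(\<Sum>j=1..b. t j) = (\<Sum>j<b. t (Suc j))"
    by (rule sum.reindex_bij_witness[of _ Suc "\<lambda>j. j - 1"]) auto
  have cyc: "(\<Sum>j<b. t (Suc j)) = (\<Sum>j<b. t j)"
    using sum.lessThan_Suc[of t b] sum.lessThan_Suc_shift[of t b] ends by (simp add: add.commute)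
  have "(\<Sum>j=1..b. t j) oo F = (\<Sum>j<b. t (Suc j) oo F)"
    by (simp only: shift fps_compose_sum_distrib)
  also have "\<dots> = fps_const ?w * (\<Sum>j=1..b. t j)"
    by (simp add: step sum_distrib_left[symmetric] shift cyc del: One_nat_def)
  finally show ?thesis
    unfolding riordan_sigma_def t_def[symmetric]
    by (simp add: fps_compose_mult_distrib F mult.left_commute del: One_nat_def)
qed

lemma riordan_sigma_compose_iterate:
  "riordan_sigma F b oo fps_iterate F m = fps_const ((F $ 1) ^ m) * riordan_sigma F b"
proof (induction m)
  case (Suc m)
  have "riordan_sigma F b oo fps_iterate F (Suc m) = (riordan_sigma F b oo fps_iterate F m) oo F"
    by (rule fps_compose_iterate[OF F, symmetric])
  also have "\<dots> = fps_const ((F $ 1) ^ m) * (riordan_sigma F b oo F)"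
    by (simp only: Suc fps_compose_mult_distrib[OF F] fps_const_compose)
  finally show ?case
    by (simp add: riordan_sigma_compose mult.assoc[symmetric] power_Suc2 del: power_Suc One_nat_def)
qed simp

text \<open>
  The multiplier determines whether an iterate is trivial because \<open>\<Sigma>\<close> conjugates \<open>F\<close> to \<open>\<omega> x\<close>: from
  \<open>\<omega>\<^sup>m = 1\<close> follows \<open>\<Sigma> \<circ> F\<^bsup>(m)\<^esup> = \<Sigma>\<close>, and \<open>\<Sigma>\<close> can be cancelled on the left.
\<close>

lemma multiplier_power_eq_1_iff: "(F $ 1) ^ m = 1 \<longleftrightarrow> fps_iterate F m = fps_X"
proof
  let ?S = "riordan_sigma F b"
  have S: "?S $ 0 = 0" "?S $ 1 \<noteq> 0"
    by (simp_all only: riordan_sigma_nth_0 riordan_sigma_nth_1) simp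
  assume "(F $ 1) ^ m = 1"
  then have "?S oo fps_iterate F m = ?S"
    by (simp add: riordan_sigma_compose_iterate)
  then have "(fps_inv ?S oo ?S) oo fps_iterate F m = fps_inv ?S oo ?S"
    by (metis fps_compose_assoc S(1) fps_iterate_nth_0[OF F])
  then show "fps_iterate F m = fps_X"
    by (simp only: fps_inv[OF S] fps_X_fps_compose_startby0[OF fps_iterate_nth_0[OF F]])
qed (use fps_iterate_nth_1[OF F, of m] in simp)

end

section \<open>Eigenvectors\<close>

text \<open>
  Column \<open>j\<close> of the matrix has generating function \<open>g F\<^sup>j\<close>. The sum over \<open>j\<close> may stop at the row index \<open>n\<close>
  because \<open>F\<^sup>j\<close> starts at degree \<open>j\<close> or later.
\<close>

lemma riordan_matrix_apply:
  fixes g F :: "'a::field fps"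
  assumes "F $ 0 = 0"
  shows "lower_triangular_apply (riordan_matrix (g, F)) (fps_nth v) n = (g * (v oo F)) $ n"
proof -
  have compose: "(v oo F) $ m = (\<Sum>j\<le>n. v $ j * (F ^ j) $ m)" if "m \<le> n" for m
    unfolding fps_compose_nth using that startsby_zero_power_prefix[OF assms]
    by (intro sum.mono_neutral_left) auto
  have "(g * (v oo F)) $ n = (\<Sum>i=0..n. \<Sum>j\<le>n. g $ i * (v $ j * (F ^ j) $ (n - i)))"
    by (simp add: fps_mult_nth compose sum_distrib_left)
  also have "\<dots> = (\<Sum>j\<le>n. \<Sum>i=0..n. g $ i * (v $ j * (F ^ j) $ (n - i)))"
    by (rule sum.swap)
  also have "\<dots> = (\<Sum>j\<le>n. (g * F ^ j) $ n * v $ j)"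
    by (simp add: fps_mult_nth sum_distrib_left sum_distrib_right mult_ac)
  finally show ?thesis
    by (simp add: lower_triangular_apply_def riordan_matrix_def)
qed

lemma riordan_eigenvector_iff:
  fixes g F :: "'a::field fps"
  assumes "F $ 0 = 0"
  shows "is_eigenvector (riordan_matrix (g, F)) (fps_nth v) c \<longleftrightarrow>
         v \<noteq> 0 \<and> g * (v oo F) = fps_const c * v"
  by (auto simp: is_eigenvector_def riordan_matrix_apply[OF assms] fun_eq_iff fps_eq_iff)

text \<open>
  Both sides of the eigenvalue equation contain the factor \<open>h\<close> and the inner series \<open>S\<close>; the hypotheses on
  \<open>h\<close> and \<open>S\<close> move \<open>g\<close> and \<open>F\<close> past them, leaving the scalar \<open>a\<close> and the substitution
  \<open>x \<mapsto> w x\<close> inside. Cancelling \<open>h\<close> and \<open>S\<close> then compares coefficients.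
\<close>

lemma conjugated_eigen_equation:
  fixes g F h S \<theta> :: "'a::field fps"
  assumes F: "F $ 0 = 0"
    and h: "h \<noteq> 0" "g * (h oo F) = fps_const a * h"
    and S: "S $ 0 = 0" "S $ 1 \<noteq> 0" "S oo F = fps_const w * S"
  shows "g * ((h * (\<theta> oo S)) oo F) = fps_const c * (h * (\<theta> oo S)) \<longleftrightarrow>
         (\<forall>n. a * w ^ n * \<theta> $ n = c * \<theta> $ n)"
proof -
  let ?L = "fps_const w * fps_X"
  have "(\<theta> oo S) oo F = \<theta> oo (?L oo S)"
    using S F by (simp add: fps_compose_assoc[symmetric] fps_compose_mult_distrib)
  also have "\<dots> = (\<theta> oo ?L) oo S"
    using S by (simp add: fps_compose_assoc)
  finally have "g * ((h * (\<theta> oo S)) oo F) = (g * (h oo F)) * ((\<theta> oo ?L) oo S)"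
    using F by (simp add: fps_compose_mult_distrib mult.assoc)
  also have "\<dots> = h * ((fps_const a * (\<theta> oo ?L)) oo S)"
    using S by (simp add: h fps_compose_mult_distrib mult_ac)
  finally have lhs: "g * ((h * (\<theta> oo S)) oo F) = h * ((fps_const a * (\<theta> oo ?L)) oo S)" .
  have rhs: "fps_const c * (h * (\<theta> oo S)) = h * ((fps_const c * \<theta>) oo S)"
    using S by (simp add: fps_compose_mult_distrib mult_ac)
  have inj: "A = B" if "A oo S = B oo S" for A B :: "'a fps"
    using arg_cong[OF that, of "\<lambda>f. f oo fps_inv S"] S fps_inv_right[OF S(1,2)]
    by (simp add: fps_compose_assoc[symmetric] fps_inv_nth_0)
  have "g * ((h * (\<theta> oo S)) oo F) = fps_const c * (h * (\<theta> oo S)) \<longleftrightarrow>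
        fps_const a * (\<theta> oo ?L) = fps_const c * \<theta>"
    unfolding lhs rhs using h(1) inj by auto
  also have "\<dots> \<longleftrightarrow> (\<forall>n. a * w ^ n * \<theta> $ n = c * \<theta> $ n)"
    by (simp add: fps_eq_iff fps_compose_linear mult.assoc)
  finally show ?thesis .
qed

text \<open>
  For \<open>w\<close> of order \<open>b\<close>, the arithmetic progression \<open>k, k + b, \<dots>\<close> consists of those \<open>n \<ge> k\<close> for which
  \<open>w\<^sup>n = w\<^sup>k\<close>.
\<close>

lemma progression_support_iff:
  fixes w :: "'a::field"
  assumes w: "\<And>m. w ^ m = 1 \<longleftrightarrow> b dvd m" "w \<noteq> 0" and k: "\<theta> $ k \<noteq> 0" "\<And>n. n < k \<Longrightarrow> \<theta> $ n = 0"
  shows "has_progression_support k b \<theta> \<longleftrightarrow> (\<forall>n. w ^ n * \<theta> $ n = w ^ k * \<theta> $ n)"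
proof -
  have "(w ^ n = w ^ k) \<longleftrightarrow> (\<exists>j. n = k + j * b)" if "\<theta> $ n \<noteq> 0" for n
  proof -
    have "n \<ge> k" using that k(2)[of n] by (meson not_le)
    have "w ^ n = w ^ k * w ^ (n - k)"
      using \<open>n \<ge> k\<close> by (simp add: power_add[symmetric])
    then have "w ^ n = w ^ k \<longleftrightarrow> b dvd n - k"
      using w by simp
    also have "\<dots> \<longleftrightarrow> (\<exists>j. n = k + j * b)"
      using \<open>n \<ge> k\<close> by (auto simp: dvd_def mult.commute) (metis le_add_diff_inverse)
    finally show ?thesis .
  qed
  then show ?thesis
    using k(1) by (auto simp: has_progression_support_def)
qed

lemma progression_support_below:
  assumes "has_progression_support k b \<theta>" "n < k"
  shows "\<theta> $ n = 0"
  using assms by (fastforce simp: has_progression_support_def)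

lemma progression_support_unique:
  assumes "has_progression_support k b \<theta>" "has_progression_support k' b \<theta>"
  shows "k = k'"
  using assms progression_support_below[OF assms(1), of k'] progression_support_below[OF assms(2), of k]
  by (metis has_progression_support_def linorder_neqE_nat)

text \<open>
  The lowest nonzero coefficient of \<open>\<theta>\<close> determines the eigenvalue, and the eigenvalue determines the residue
  class of exponents that may occur.
\<close>

lemma eigen_coefficients_iff:
  fixes w a :: "'a::field"
  assumes w: "\<And>m. w ^ m = 1 \<longleftrightarrow> b dvd m" "w \<noteq> 0" and a: "a \<noteq> 0"
  shows "\<theta> \<noteq> 0 \<and> (\<forall>n. a * w ^ n * \<theta> $ n = c * \<theta> $ n) \<longleftrightarrow>
         (\<exists>k. has_progression_support k b \<theta> \<and> c = a * w ^ k)"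
proof safe
  assume "\<theta> \<noteq> 0" and eq: "\<forall>n. a * w ^ n * \<theta> $ n = c * \<theta> $ n"
  define k where "k = subdegree \<theta>"
  have k: "\<theta> $ k \<noteq> 0" "\<And>n. n < k \<Longrightarrow> \<theta> $ n = 0"
    using \<open>\<theta> \<noteq> 0\<close> by (auto simp: k_def)
  have c: "c = a * w ^ k"
    using eq[rule_format, of k] k by simp
  then have "has_progression_support k b \<theta>"
    using eq a by (simp add: progression_support_iff[OF w k] mult.assoc)
  with c show "\<exists>k. has_progression_support k b \<theta> \<and> c = a * w ^ k" by blast
next
  fix k n
  assume k: "has_progression_support k b \<theta>"
  then have "\<theta> $ k \<noteq> 0" by (simp add: has_progression_support_def)
  from progression_support_iff[OF w this progression_support_below[OF k]] k
  show "a * w ^ n * \<theta> $ n = a * w ^ k * \<theta> $ n"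
    by (simp add: mult.assoc)
qed (auto simp: has_progression_support_def)

lemma leading_coefficient_compose:
  fixes h S \<theta> :: "'a::field fps"
  assumes S: "S $ 0 = 0" "S $ 1 = 1" and \<theta>: "\<And>n. n < k \<Longrightarrow> \<theta> $ n = 0"
  shows "n < k \<Longrightarrow> (h * (\<theta> oo S)) $ n = 0" "(h * (\<theta> oo S)) $ k = h $ 0 * \<theta> $ k"
proof -
  have low: "(\<theta> oo S) $ n = 0" if "n < k" for n
    using that \<theta> by (simp add: fps_compose_nth)
  have "(\<theta> oo S) $ k = (\<Sum>i\<in>{k}. \<theta> $ i * (S ^ i) $ k)"
    unfolding fps_compose_nth using \<theta> by (intro sum.mono_neutral_right) auto
  then have top: "(\<theta> oo S) $ k = \<theta> $ k"
    using S by (simp add: startsby_zero_power_nth_same)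
  show "(h * (\<theta> oo S)) $ n = 0" if "n < k"
    using that low by (simp add: fps_mult_nth)
  have "(h * (\<theta> oo S)) $ k = (\<Sum>i\<in>{0}. h $ i * (\<theta> oo S) $ (k - i))"
    unfolding fps_mult_nth using low by (intro sum.mono_neutral_right) auto
  then show "(h * (\<theta> oo S)) $ k = h $ 0 * \<theta> $ k"
    by (simp add: top)
qed

theorem theorem3:
  fixes g F :: "'a::field_char_0 fps" and b :: nat and \<omega> :: 'a
  assumes riordan: "(g, F) \<in> carrier riordan_group"
    and finite_order: "group.ord riordan_group (g, F) > 0"
    and omega: "\<omega> = F $ 1"
    and order_F: "group.ord fps_comp_group F = b"
    and b: "b > 1"
  shows "group.ord nonzero_group \<omega> = b \<and>
    (\<forall>v :: 'a fps.
      (\<exists>w c. is_eigenvector (riordan_matrix (g, F)) w c \<and> v = Abs_fps w) \<longleftrightarrow>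
      (\<exists>k \<theta>. has_progression_support k b \<theta> \<and>
             v = riordan_h g F b * (\<theta> oo riordan_sigma F b))) \<and>
    (\<forall>(v :: 'a fps) k \<theta>.
      has_progression_support k b \<theta> \<and> v = riordan_h g F b * (\<theta> oo riordan_sigma F b) \<longrightarrow>
      (\<forall>n<k. v $ n = 0) \<and> v $ k = riordan_h g F b $ 0 * \<theta> $ k \<and>
      (\<forall>c. is_eigenvector (riordan_matrix (g, F)) (fps_nth v) c \<longleftrightarrow> c = g $ 0 * \<omega> ^ k))"
proof -
  interpret C: group "fps_comp_group :: 'a fps monoid"
    by (rule group_fps_comp_group)
  interpret N: group "nonzero_group :: 'a monoid"
    by (rule group_nonzero_group)
  have F: "F \<in> carrier fps_comp_group" "F $ 0 = 0" "F $ 1 \<noteq> 0" and g0: "g $ 0 \<noteq> 0"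
    using riordan by (auto simp: riordan_group_def fps_comp_group_def)
  have Fb: "fps_iterate F b = fps_X"
    using C.pow_ord_eq_1[OF F(1)] order_F by (simp add: fps_comp_group_def)
  have b0: "b > 0" using b by simp
  note sigma = riordan_sigma_nth_0[OF F(2) b0 Fb] riordan_sigma_nth_1[OF F(2) b0 Fb]
    riordan_sigma_compose[OF F(2) b0 Fb, folded omega]
  let ?h = "riordan_h g F b" and ?S = "riordan_sigma F b"
  have \<omega>: "\<omega> \<noteq> 0" using F omega by simp
  have roots: "\<omega> ^ m = 1 \<longleftrightarrow> b dvd m" for m
    using multiplier_power_eq_1_iff[OF F(2) b0 Fb, of m] C.pow_eq_id[OF F(1), of m] order_F
    by (simp add: omega fps_comp_group_def)
  have pow: "\<omega> [^]\<^bsub>nonzero_group\<^esub> m = \<omega> ^ m" for m :: nat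
    by (induction m) (simp_all add: nonzero_group_def mult.commute)
  have "N.ord \<omega> dvd m \<longleftrightarrow> b dvd m" for m
    using N.pow_eq_id[of \<omega> m] \<omega> roots[of m] pow[of m] by (simp add: nonzero_group_def)
  then have order: "N.ord \<omega> = b"
    by (meson dvd_antisym dvd_refl)
  have h0: "?h $ 0 = 1"
    using b0 g0 by (rule riordan_h_nth_0)
  then have h: "?h \<noteq> 0" by auto
  have S1: "?S $ 1 \<noteq> 0" using sigma(2) by simp
  have zero_iff: "?h * (\<theta> oo ?S) = 0 \<longleftrightarrow> \<theta> = 0" for \<theta>
    using h fps_compose_eq_0_iff[of ?S \<theta>] sigma(1) S1 by auto
  have eigen: "is_eigenvector (riordan_matrix (g, F)) (fps_nth (?h * (\<theta> oo ?S))) c \<longleftrightarrow>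
      (\<exists>k. has_progression_support k b \<theta> \<and> c = g $ 0 * \<omega> ^ k)" for \<theta> c
    unfolding riordan_eigenvector_iff[OF F(2)] zero_iff
      conjugated_eigen_equation[OF F(2) h riordan_h_eigen[OF riordan finite_order order_F b] sigma(1) S1 sigma(3)]
    by (rule eigen_coefficients_iff[OF roots \<omega> g0])
  \<comment> \<open>Division by \<open>h\<close> and substitution of the compositional inverse of \<open>\<Sigma>\<close> recover \<open>\<theta>\<close> from \<open>v\<close>.\<close>
  have represent: "\<exists>\<theta>. v = ?h * (\<theta> oo ?S)" for v
  proof
    have "((v * inverse ?h) oo fps_inv ?S) oo ?S = v * inverse ?h"
      using fps_inv[OF sigma(1) S1] sigma(1)
      by (simp add: fps_compose_assoc[symmetric] fps_inv_nth_0)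
    then show "v = ?h * (((v * inverse ?h) oo fps_inv ?S) oo ?S)"
      using inverse_mult_eq_1'[of ?h] h0 by (simp add: mult.left_commute)
  qed
  have "(\<exists>w c. is_eigenvector (riordan_matrix (g, F)) w c \<and> v = Abs_fps w) \<longleftrightarrow>
      (\<exists>k \<theta>. has_progression_support k b \<theta> \<and> v = ?h * (\<theta> oo ?S))" (is "?L \<longleftrightarrow> ?R") for v
  proof
    assume ?L
    then obtain w c where "is_eigenvector (riordan_matrix (g, F)) w c" "v = Abs_fps w" by blast
    then have c: "is_eigenvector (riordan_matrix (g, F)) (fps_nth v) c"
      by (simp add: Abs_fps_inverse)
    obtain \<theta> where v: "v = ?h * (\<theta> oo ?S)" using represent by blast
    from c obtain k where "has_progression_support k b \<theta>"
      unfolding v eigen by blast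
    with v show ?R by blast
  next
    assume ?R
    then obtain k \<theta> where k: "has_progression_support k b \<theta>" and v: "v = ?h * (\<theta> oo ?S)" by blast
    from k have "is_eigenvector (riordan_matrix (g, F)) (fps_nth v) (g $ 0 * \<omega> ^ k)"
      unfolding v eigen by blast
    then show ?L
      by (intro exI[of _ "fps_nth v"] exI[of _ "g $ 0 * \<omega> ^ k"]) (simp add: fps_nth_inverse)
  qed
  moreover have "(\<forall>n<k. v $ n = 0) \<and> v $ k = ?h $ 0 * \<theta> $ k \<and>
      (\<forall>c. is_eigenvector (riordan_matrix (g, F)) (fps_nth v) c \<longleftrightarrow> c = g $ 0 * \<omega> ^ k)"
    if k: "has_progression_support k b \<theta>" and v: "v = ?h * (\<theta> oo ?S)" for v k \<theta>
  proof -
    have "is_eigenvector (riordan_matrix (g, F)) (fps_nth v) c \<longleftrightarrow> c = g $ 0 * \<omega> ^ k" for c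
      unfolding v eigen using k progression_support_unique[OF k] by blast
    moreover have "v $ n = 0" if "n < k" for n
      unfolding v using sigma(1,2) progression_support_below[OF k] that
      by (rule leading_coefficient_compose(1))
    moreover have "v $ k = ?h $ 0 * \<theta> $ k"
      unfolding v using sigma(1,2) progression_support_below[OF k]
      by (rule leading_coefficient_compose(2))
    ultimately show ?thesis by blast
  qed
  ultimately show ?thesis
    using order by blast
qed

end
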